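(* Let $p,q$ be positive integers, let $M\in\mathbb{S}^{p,q}$ and $N\in\mathbf{\Pi}_{1,qp}$. Assume that $N_{22}=Q_{22}\otimes I_p$ for some $Q_{22}\in\mathbb{S}^q$. Define $Q\in\mathbb{S}^{p,q}$ by $$Q:=\begin{bmatrix}(N|N_{22})I_p+Q_{12}Q_{22}^{\dagger}Q_{21} & Q_{12}\\ Q_{21} & Q_{22}\end{bmatrix},$$ where $Q_{12}\in\mathbb{R}^{p\times q}$ is determined by $\operatorname{vec}(Q_{12})=N_{21}$ and $Q_{21}=Q_{12}^{\top}$. Then the implication $$Z\in\mathbb{R}^{q\times p}\text{ and }\operatorname{vec}(Z^{\top})\in\mathcal{Z}_{qp}(N)\ \Rightarrow\ Z\in\mathcal{Z}_q(M)\qquad(\ast)$$ holds if and only if $$Z\in\mathcal{Z}_q(Q)\ \Rightarrow\ Z\in\mathcal{Z}_q(M).$$ Moreover, assume that $N|N_{22}>0$. Then the implication $(\ast)$ holds if and only if there exists a scalar $\alpha\ge 0$ such that $M-\alpha Q\ge 0$.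
   Context: All matrices are real. $\mathbb{S}^n$ is the set of symmetric $n\times n$ matrices; for symmetric matrices, $\ge,>,\le,<$ refer to positive/negative (semi)definiteness. $\mathbb{S}^{p,q}$ is the set of symmetric $(p+q)\times(p+q)$ matrices $\Pi$ partitioned as $\Pi=\begin{bmatrix}\Pi_{11}&\Pi_{12}\\ \Pi_{21}&\Pi_{22}\end{bmatrix}$ with $\Pi_{11}\in\mathbb{S}^p$, $\Pi_{22}\in\mathbb{S}^q$. $Y^{\dagger}$ is the Moore-Penrose pseudoinverse, $\otimes$ the Kronecker product, and $\operatorname{vec}(Y)$ stacks the columns of $Y$ into one column vector. The generalized Schur complement is $\Pi|\Pi_{22}:=\Pi_{11}-\Pi_{12}\Pi_{22}^{\dagger}\Pi_{21}$. Define $$\mathbf{\Pi}_{p,q}:=\{\Pi\in\mathbb{S}^{p,q}\mid \Pi_{22}\le 0,\ \ker\Pi_{22}\subseteq\ker\Pi_{12},\ \Pi|\Pi_{22}\ge 0\}.$$ For $\Pi\in\mathbb{S}^{p,q}$, $$\mathcal{Z}_q(\Pi):=\Big\{Z\in\mathbb{R}^{q\times p}\ \Big|\ \begin{bmatrix}I\\Z\end{bmatrix}^{\top}\Pi\begin{bmatrix}I\\Z\end{bmatrix}\ge 0\Big\}.$$ (For $N\in\mathbb{S}^{1,qp}$, $\mathcal{Z}_{qp}(N)$ is thus a set of vectors in $\mathbb{R}^{qp}$, and $N|N_{22}$ is a scalar.) *)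

theory Defs
  imports "HOL-Analysis.Analysis"
begin

(* A p x q matrix has type real^'q^'p with CARD('p) = p and CARD('q) = q; finite index types are
   nonempty, so p, q >= 1.  A matrix partitioned into blocks of sizes p and q is indexed by the
   sum type 'p + 'q, so its partition is part of its type. *)

definition sym_mats :: "(real^'n^'n) set" where
  "sym_mats = {A. transpose A = A}"

(* The library order \<le> on real^'n^'n is componentwise; the semidefinite order is separate. *)
definition loewner_le :: "real^'n^'n \<Rightarrow> real^'n^'n \<Rightarrow> bool" (infix "\<preceq>" 50) where
  "A \<preceq> B \<longleftrightarrow> A \<in> sym_mats \<and> B \<in> sym_mats \<and> (\<forall>x. x \<bullet> (A *v x) \<le> x \<bullet> (B *v x))"

definition mat_ker :: "real^'n^'m \<Rightarrow> (real^'n) set" where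
  "mat_ker A = {x. A *v x = 0}"

(* The four Penrose equations. *)
definition is_pinv :: "real^'n^'m \<Rightarrow> real^'m^'n \<Rightarrow> bool" where
  "is_pinv A X \<longleftrightarrow> A ** X ** A = A \<and> X ** A ** X = X \<and>
     transpose (A ** X) = A ** X \<and> transpose (X ** A) = X ** A"

definition pinv :: "real^'n^'m \<Rightarrow> real^'m^'n" where
  "pinv A = (THE X. is_pinv A X)"

(* Rows and columns of a Kronecker product are indexed by pairs, read lexicographically:
   the first component selects the block, the second the position inside the block. *)
definition kron :: "real^'n^'m \<Rightarrow> real^'l^'k \<Rightarrow> real^('n::finite \<times> 'l::finite)^('m::finite \<times> 'k::finite)" where
  "kron A B = (\<chi> r c. A $ fst r $ fst c * B $ snd r $ snd c)"

(* Stacked columns, as a one-column matrix: with the same lexicographic reading of pairs,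
   row (j, i) holds entry i of column j. *)
definition mvec :: "real^'n^'m \<Rightarrow> real^1^('n::finite \<times> 'm::finite)" where
  "mvec Y = (\<chi> r c. Y $ snd r $ fst r)"

definition block_mat ::
  "real^'p^'p \<Rightarrow> real^'q^'p \<Rightarrow> real^'p^'q \<Rightarrow> real^'q^'q \<Rightarrow> real^('p::finite + 'q::finite)^('p + 'q)" where
  "block_mat A B C D = (\<chi> r c. case r of
       Inl i \<Rightarrow> (case c of Inl j \<Rightarrow> A $ i $ j | Inr j \<Rightarrow> B $ i $ j)
     | Inr i \<Rightarrow> (case c of Inl j \<Rightarrow> C $ i $ j | Inr j \<Rightarrow> D $ i $ j))"

definition blk11 :: "real^('p::finite + 'q::finite)^('p + 'q) \<Rightarrow> real^'p^'p" where
  "blk11 P = (\<chi> i j. P $ Inl i $ Inl j)"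

definition blk12 :: "real^('p::finite + 'q::finite)^('p + 'q) \<Rightarrow> real^'q^'p" where
  "blk12 P = (\<chi> i j. P $ Inl i $ Inr j)"

definition blk21 :: "real^('p::finite + 'q::finite)^('p + 'q) \<Rightarrow> real^'p^'q" where
  "blk21 P = (\<chi> i j. P $ Inr i $ Inl j)"

definition blk22 :: "real^('p::finite + 'q::finite)^('p + 'q) \<Rightarrow> real^'q^'q" where
  "blk22 P = (\<chi> i j. P $ Inr i $ Inr j)"

definition schur :: "real^('p::finite + 'q::finite)^('p + 'q) \<Rightarrow> real^'p^'p" where
  "schur P = blk11 P - blk12 P ** pinv (blk22 P) ** blk21 P"

definition Pi_set :: "(real^('p::finite + 'q::finite)^('p + 'q)) set" where
  "Pi_set = {P \<in> sym_mats. blk22 P \<preceq> 0 \<and> mat_ker (blk22 P) \<subseteq> mat_ker (blk12 P) \<and> 0 \<preceq> schur P}"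

(* The block column with identity on top and Z below. *)
definition stack_id :: "real^'p^'q \<Rightarrow> real^'p^('p::finite + 'q::finite)" where
  "stack_id Z = (\<chi> r c. case r of Inl i \<Rightarrow> mat 1 $ i $ c | Inr i \<Rightarrow> Z $ i $ c)"

definition Zset :: "real^('p::finite + 'q::finite)^('p + 'q) \<Rightarrow> (real^'p^'q) set" where
  "Zset P = {Z. 0 \<preceq> transpose (stack_id Z) ** P ** stack_id Z}"

end

(* The centre of all sets is -C with C = pinv Q22 Q21.  Put D = Z + C.  Completing squares, the
   condition on N reads 0 <= s + tr (D^T Q22 D), while Z in Zset Q reads 0 <= s I + D^T Q22 D: a
   bound on the Frobenius norm versus the same bound on the spectral norm of sqrt (-Q22) D.  The
   first implies the second.  Conversely the condition defining Zset M is tested on one vector x at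
   a time, and on x alone D may be replaced by the rank-one matrix D x x^T / |x|^2, whose two
   norms agree.  Hence the implication says that the quadratic form of M is nonnegative wherever
   that of Q is, first on vectors with nonzero upper block and then, by a limit, on all vectors; the
   S-lemma turns this into the multiplier, with s > 0 providing a point where the form of Q is
   positive. *)
theory Submission
  imports Defs
begin

section \<open>Existence and uniqueness of the Moore-Penrose pseudoinverse\<close>

lemma matrix_eqI_vec:
  fixes A B :: "real^'n^'m"
  assumes "\<And>x. A *v x = B *v x"
  shows "A = B"
  using assms by (simp add: matrix_eq)

lemma inner_transpose_mult: "(transpose A *v x) \<bullet> y = x \<bullet> (A *v y)"
  for A :: "real^'n^'m"
  by (simp add: dot_lmul_matrix)

text \<open>If A^T A u = 0 then |A u|^2 = u . (A^T A u) = 0, so A^T A and A have the same kernel;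
  this is applied to u = Y x - Z x.\<close>

lemma gram_cancel:
  fixes A :: "real^'n^'m" and Y Z :: "real^'k^'n"
  assumes "transpose A ** A ** Y = transpose A ** A ** Z"
  shows "A ** Y = A ** Z"
proof (rule matrix_eqI_vec)
  fix x
  let ?u = "Y *v x - Z *v x"
  have "transpose A *v (A *v ?u) = 0"
    using arg_cong[OF assms, of "\<lambda>B. B *v x"]
    by (simp add: matrix_vector_mult_diff_distrib matrix_vector_mul_assoc matrix_mul_assoc)
  then have "(A *v ?u) \<bullet> (A *v ?u) = 0"
    by (simp flip: inner_transpose_mult[of A])
  then show "(A ** Y) *v x = (A ** Z) *v x"
    by (simp add: matrix_vector_mult_diff_distrib flip: matrix_vector_mul_assoc)
qed

lemma exists_generalized_inverse:
  fixes A :: "real^'n^'m"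
  shows "\<exists>G :: real^'m^'n. A ** G ** A = A"
proof -
  have lin: "linear ((*v) A)" by simp
  obtain g where g: "linear g" "\<And>v. v \<in> range ((*v) A) \<Longrightarrow> A *v g v = v"
    using linear_exists_right_inverse_on[OF lin subspace_UNIV] by auto
  have "A ** matrix g ** A = A"
    by (rule matrix_eqI_vec)
      (simp add: g matrix_works matrix_vector_mul_assoc[symmetric])
  then show ?thesis ..
qed

text \<open>Two applications of \<open>gram_cancel\<close> strip the outer left factors one at a
  time: first A^T from A^T A, then A from A A^T.\<close>

lemma generalized_inverse_gram_cancel:
  fixes A :: "real^'n^'m"
  assumes "(transpose A ** A ** transpose A) ** G ** (transpose A ** A ** transpose A)
             = transpose A ** A ** transpose A"
  shows "transpose A ** G ** transpose A ** A ** transpose A = transpose A"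
proof -
  have "A ** (transpose A ** G ** transpose A ** A ** transpose A) = A ** transpose A"
    by (rule gram_cancel) (use assms in \<open>simp add: matrix_mul_assoc\<close>)
  then have "transpose A ** (G ** transpose A ** A ** transpose A) = transpose A ** mat 1"
    by (intro gram_cancel[where A = "transpose A"]) (simp add: matrix_mul_assoc)
  then show ?thesis by (simp add: matrix_mul_assoc)
qed

text \<open>Zlobec's formula: A^T G A^T is the pseudoinverse whenever G is a generalized inverse of
  A^T A A^T, and some such G comes from a right inverse on the range.\<close>

lemma is_pinv_exists:
  fixes A :: "real^'n^'m"
  shows "\<exists>X. is_pinv A X"
proof -
  let ?T = "transpose A"
  obtain G where G: "(?T ** A ** ?T) ** G ** (?T ** A ** ?T) = ?T ** A ** ?T"
    using exists_generalized_inverse by blast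
  define X where "X = ?T ** G ** ?T"
  have 1: "X ** A ** ?T = ?T"
    using generalized_inverse_gram_cancel[OF G] by (simp add: X_def)
  \<comment> \<open>The same cancellation with A^T in place of A; \<open>transpose G\<close> is a
    generalized inverse of A A^T A.\<close>
  have "A ** transpose G ** A ** ?T ** A = A"
    using generalized_inverse_gram_cancel[of "?T" "transpose G"] arg_cong[OF G, of transpose]
    by (simp add: matrix_transpose_mul matrix_mul_assoc)
  from arg_cong[OF this, of transpose] have 2: "?T ** A ** X = ?T"
    by (simp add: matrix_transpose_mul matrix_mul_assoc X_def)
  have R: "A ** transpose (X ** A) = A"
    using arg_cong[OF 1, of transpose] by (simp add: matrix_transpose_mul matrix_mul_assoc)
  \<comment> \<open>A matrix B with B B^T = B is symmetric, because B B^T is. The second projection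
    A X is treated in the same way below.\<close>
  then have RR: "(X ** A) ** transpose (X ** A) = X ** A"
    by (metis matrix_mul_assoc)
  have Rsym: "transpose (X ** A) = X ** A"
    using arg_cong[OF RR, of transpose] RR by (simp add: matrix_transpose_mul)
  have P: "transpose (A ** X) ** A = A"
    using arg_cong[OF 2, of transpose] by (simp add: matrix_transpose_mul matrix_mul_assoc)
  then have PP: "transpose (A ** X) ** (A ** X) = A ** X"
    by (metis matrix_mul_assoc)
  have Psym: "transpose (A ** X) = A ** X"
    using arg_cong[OF PP, of transpose] PP by (simp add: matrix_transpose_mul)
  have "X ** A ** X = (X ** A ** ?T) ** G ** ?T"
    by (simp add: X_def matrix_mul_assoc)
  also have "\<dots> = X" unfolding 1 by (simp add: X_def)
  finally have "X ** A ** X = X" .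
  moreover have "A ** X ** A = A" using P Psym by simp
  ultimately show ?thesis using Psym Rsym by (auto simp: is_pinv_def)
qed

lemma is_pinv_transpose:
  assumes "is_pinv A X"
  shows "is_pinv (transpose A) (transpose X)"
proof -
  note X = assms[unfolded is_pinv_def]
  have "transpose A ** transpose X ** transpose A = transpose (A ** X ** A)"
    "transpose X ** transpose A ** transpose X = transpose (X ** A ** X)"
    by (simp_all only: matrix_transpose_mul matrix_mul_assoc)
  moreover have "transpose A ** transpose X = X ** A" "transpose X ** transpose A = A ** X"
    using X by (simp_all only: matrix_transpose_mul[symmetric])
  ultimately show ?thesis using X by (simp add: is_pinv_def)
qed

text \<open>Both sides are the orthogonal projection onto the range of A: each absorbs the other,
  and symmetry lets the order of the factors be exchanged.\<close>

lemma is_pinv_proj_unique: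
  assumes X: "is_pinv A X" and Y: "is_pinv A Y"
  shows "A ** X = A ** Y"
proof -
  have "A ** X = transpose (A ** X)" using X by (simp add: is_pinv_def)
  also have "\<dots> = transpose (A ** Y ** (A ** X))"
    using Y by (simp add: is_pinv_def matrix_mul_assoc)
  also have "\<dots> = transpose (A ** X) ** transpose (A ** Y)"
    by (rule matrix_transpose_mul)
  also have "\<dots> = A ** X ** (A ** Y)" using X Y by (simp add: is_pinv_def)
  also have "\<dots> = A ** Y" using X by (simp add: is_pinv_def matrix_mul_assoc)
  finally show ?thesis .
qed

lemma is_pinv_unique:
  assumes X: "is_pinv A X" and Y: "is_pinv A Y"
  shows "X = Y"
proof -
  have "transpose (X ** A) = transpose (Y ** A)"
    using is_pinv_proj_unique[OF is_pinv_transpose[OF X] is_pinv_transpose[OF Y]]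
    by (simp only: matrix_transpose_mul)
  then have XA: "X ** A = Y ** A" using X Y by (simp add: is_pinv_def)
  have "X = X ** A ** X" using X by (simp add: is_pinv_def)
  also have "\<dots> = Y ** (A ** X)" by (simp add: XA matrix_mul_assoc)
  also have "\<dots> = Y ** A ** Y" by (simp add: is_pinv_proj_unique[OF X Y] matrix_mul_assoc)
  also have "\<dots> = Y" using Y by (simp add: is_pinv_def)
  finally show ?thesis .
qed

lemma is_pinv_pinv: "is_pinv A (pinv A)"
  unfolding pinv_def by (rule theI') (use is_pinv_exists is_pinv_unique in blast)

lemma pinv_eqI: "is_pinv A X \<Longrightarrow> pinv A = X"
  using is_pinv_pinv is_pinv_unique by blast

lemma pinv_transpose: "pinv (transpose A) = transpose (pinv A)"
  by (intro pinv_eqI is_pinv_transpose is_pinv_pinv)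

section \<open>Kronecker products and vectorization\<close>

lemma kron_mult: "kron A B ** kron C D = kron (A ** C) (B ** D)"
  by (simp add: kron_def matrix_matrix_mult_def vec_eq_iff sum_product sum.cartesian_product
      UNIV_Times_UNIV[symmetric] case_prod_beta algebra_simps del: UNIV_Times_UNIV)

lemma transpose_kron: "transpose (kron A B) = kron (transpose A) (transpose B)"
  by (simp add: kron_def transpose_def vec_eq_iff)

lemma pinv_kron: "pinv (kron A B) = kron (pinv A) (pinv B)"
  using is_pinv_pinv[of A] is_pinv_pinv[of B]
  by (intro pinv_eqI) (simp add: is_pinv_def kron_mult transpose_kron)

lemma pinv_mat_1: "pinv (mat 1) = mat 1"
  by (rule pinv_eqI) (simp add: is_pinv_def)

text \<open>The case B = I of the rule (A kron B) vec Y = vec (B Y A^T). It makes A act on each row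
  of Y separately.\<close>

lemma kron_mult_mvec: "kron A (mat 1) ** mvec Y = mvec (Y ** transpose A)"
proof -
  have "(\<Sum>k\<in>UNIV. A $ a $ fst k * (mat 1 $ b $ snd k) * Y $ snd k $ fst k)
      = (\<Sum>j\<in>UNIV. Y $ b $ j * A $ a $ j)" for a b
  proof -
    have "(\<Sum>k\<in>UNIV. A $ a $ fst k * (mat 1 $ b $ snd k) * Y $ snd k $ fst k)
        = (\<Sum>j\<in>UNIV. \<Sum>i\<in>UNIV. A $ a $ j * (mat 1 $ b $ i) * Y $ i $ j)"
      by (simp add: sum.cartesian_product UNIV_Times_UNIV[symmetric] case_prod_beta
          del: UNIV_Times_UNIV)
    then show ?thesis
      by (simp add: mat_def if_distrib if_distribR mult.commute cong: if_cong)
  qed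
  then show ?thesis
    by (simp add: kron_def mvec_def matrix_matrix_mult_def vec_eq_iff transpose_def)
qed

lemma inner_mvec:
  "(mvec Y *v x) \<bullet> (mvec W *v x) = (x \<bullet> x) * (\<Sum>i\<in>UNIV. Y $ i \<bullet> W $ i)"
proof -
  have "(mvec Y *v x) \<bullet> (mvec W *v x)
      = (\<Sum>r\<in>UNIV. (x \<bullet> x) * (Y $ snd r $ fst r * W $ snd r $ fst r))"
    by (simp add: mvec_def matrix_vector_mult_def inner_vec_def sum_1 algebra_simps)
  also have "\<dots> = (x \<bullet> x) * (\<Sum>j\<in>UNIV. \<Sum>i\<in>UNIV. Y $ i $ j * W $ i $ j)"
    by (simp add: sum_distrib_left sum.cartesian_product UNIV_Times_UNIV[symmetric] case_prod_beta
        del: UNIV_Times_UNIV)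
  also have "(\<Sum>j\<in>UNIV. \<Sum>i\<in>UNIV. Y $ i $ j * W $ i $ j) = (\<Sum>i\<in>UNIV. Y $ i \<bullet> W $ i)"
    by (subst sum.swap) (simp add: inner_vec_def)
  finally show ?thesis .
qed

lemma matrix_mult_transpose_nth: "(Y ** transpose A) $ i = A *v Y $ i"
  for A :: "real^'n^'m"
  by (simp add: matrix_matrix_mult_def matrix_vector_mult_def transpose_def vec_eq_iff mult.commute)

lemma kron_form_mvec:
  "(mvec Y *v x) \<bullet> (kron A (mat 1) *v (mvec Y *v x)) = (x \<bullet> x) * (\<Sum>i\<in>UNIV. Y $ i \<bullet> (A *v Y $ i))"
  by (simp add: matrix_vector_mul_assoc kron_mult_mvec inner_mvec matrix_mult_transpose_nth)

section \<open>Block vectors, quadratic forms and completing the square\<close>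

lemma pinv_sym_mats:
  assumes "A \<in> sym_mats"
  shows "transpose (pinv A) = pinv A"
proof -
  have "transpose (pinv A) = pinv (transpose A)" by (rule pinv_transpose[symmetric])
  also have "transpose A = A" using assms by (simp add: sym_mats_def)
  finally show ?thesis .
qed

lemma inner_sym_mats:
  assumes "A \<in> sym_mats"
  shows "x \<bullet> (A *v y) = (A *v x) \<bullet> y"
  using assms inner_transpose_mult[of A x y] by (simp add: sym_mats_def)

definition vjoin :: "real^'p \<Rightarrow> real^'q \<Rightarrow> real^('p::finite + 'q::finite)" where
  "vjoin x z = (\<chi> r. case r of Inl i \<Rightarrow> x $ i | Inr j \<Rightarrow> z $ j)"

lemma vjoin_cases:
  obtains x z where "v = vjoin x z"
proof
  show "v = vjoin (\<chi> i. v $ Inl i) (\<chi> j. v $ Inr j)"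
    by (simp add: vjoin_def vec_eq_iff split: sum.split)
qed

lemma vjoin_add: "vjoin x z + vjoin x' z' = vjoin (x + x') (z + z')"
  by (simp add: vjoin_def vec_eq_iff split: sum.split)

lemma vjoin_scaleR: "c *\<^sub>R vjoin x z = vjoin (c *\<^sub>R x) (c *\<^sub>R z)"
  by (simp add: vjoin_def vec_eq_iff split: sum.split)

lemma sum_UNIV_Plus:
  fixes f :: "'a::finite + 'b::finite \<Rightarrow> 'c::comm_monoid_add"
  shows "sum f UNIV = (\<Sum>i\<in>UNIV. f (Inl i)) + (\<Sum>j\<in>UNIV. f (Inr j))"
  by (subst UNIV_Plus_UNIV[symmetric], subst sum.Plus) auto

lemma inner_vjoin: "vjoin x z \<bullet> vjoin x' z' = x \<bullet> x' + z \<bullet> z'"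
  by (simp add: inner_vec_def sum_UNIV_Plus vjoin_def)

lemma matrix_mult_vjoin:
  "P *v vjoin x z = vjoin (blk11 P *v x + blk12 P *v z) (blk21 P *v x + blk22 P *v z)"
  by (simp add: vjoin_def vec_eq_iff matrix_vector_mult_def sum_UNIV_Plus
      blk11_def blk12_def blk21_def blk22_def split: sum.split)

lemma stack_id_mult: "stack_id Z *v x = vjoin x (Z *v x)"
proof -
  have "(\<Sum>j\<in>UNIV. mat 1 $ i $ j * x $ j) = x $ i" for i
    using matrix_vector_mul_lid[of x] by (simp add: matrix_vector_mult_def vec_eq_iff)
  then show ?thesis
    by (auto simp: stack_id_def vjoin_def vec_eq_iff matrix_vector_mult_def split: sum.split)
qed

text \<open>Reduces the matrix inequality to single test vectors, so that later Z may be replaced by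
  any matrix agreeing with it at one x.\<close>

lemma Zset_iff:
  assumes "P \<in> sym_mats"
  shows "Z \<in> Zset P \<longleftrightarrow> (\<forall>x. 0 \<le> vjoin x (Z *v x) \<bullet> (P *v vjoin x (Z *v x)))"
proof -
  have "transpose (stack_id Z) ** P ** stack_id Z \<in> sym_mats"
    using assms by (simp add: sym_mats_def matrix_transpose_mul matrix_mul_assoc)
  moreover have "(0 :: real^'a^'a) \<in> sym_mats"
    by (simp add: sym_mats_def transpose_def vec_eq_iff)
  moreover have "x \<bullet> ((transpose (stack_id Z) ** P ** stack_id Z) *v x)
      = vjoin x (Z *v x) \<bullet> (P *v vjoin x (Z *v x))" for x
    using inner_transpose_mult[of "stack_id Z" "P *v vjoin x (Z *v x)" x]
    by (simp add: stack_id_mult inner_commute flip: matrix_vector_mul_assoc)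
  ultimately show ?thesis by (simp add: Zset_def loewner_le_def)
qed

lemma blk_transpose:
  assumes "P \<in> sym_mats"
  shows "transpose (blk12 P) = blk21 P" "transpose (blk21 P) = blk12 P" "blk22 P \<in> sym_mats"
  using assms by (auto simp: sym_mats_def transpose_def blk12_def blk21_def blk22_def vec_eq_iff)

text \<open>By the first Penrose equation \<open>pinv A ** A\<close> moves a vector only within its
  coset of the kernel of A, which B does not see.\<close>

lemma pinv_ker_absorb:
  fixes A :: "real^'n^'m" and B :: "real^'n^'k"
  assumes "mat_ker A \<subseteq> mat_ker B"
  shows "B ** pinv A ** A = B"
proof (rule matrix_eqI_vec)
  fix y
  have "A *v (pinv A *v (A *v y) - y) = 0"
    using is_pinv_pinv[of A]
    by (simp add: is_pinv_def matrix_vector_mult_diff_distrib matrix_vector_mul_assoc matrix_mul_assoc)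
  with assms have "B *v (pinv A *v (A *v y) - y) = 0" by (auto simp: mat_ker_def)
  then show "(B ** pinv A ** A) *v y = B *v y"
    by (simp add: matrix_vector_mult_diff_distrib matrix_vector_mul_assoc matrix_mul_assoc)
qed

text \<open>The kernel condition gives P22 C = P21, hence the cross terms of the form are exactly
  those of the square centred at -C x.\<close>

lemma form_complete_square:
  assumes P: "P \<in> sym_mats" and ker: "mat_ker (blk22 P) \<subseteq> mat_ker (blk12 P)"
  defines "C \<equiv> pinv (blk22 P) ** blk21 P"
  shows "vjoin x z \<bullet> (P *v vjoin x z)
    = x \<bullet> (schur P *v x) + (z + C *v x) \<bullet> (blk22 P *v (z + C *v x))"
proof -
  note sym = blk_transpose[OF P]
  have sym22: "transpose (blk22 P) = blk22 P" using sym by (simp add: sym_mats_def)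
  note symX = pinv_sym_mats[OF sym(3)]
  have "blk12 P ** pinv (blk22 P) ** blk22 P = blk12 P" by (rule pinv_ker_absorb[OF ker])
  from arg_cong[OF this, of transpose] have "blk22 P ** C = blk21 P"
    by (simp add: C_def matrix_transpose_mul sym sym22 symX matrix_mul_assoc)
  then have C: "blk22 P *v (C *v y) = blk21 P *v y" for y
    by (simp add: matrix_vector_mul_assoc)
  have 12: "u \<bullet> (blk12 P *v w) = w \<bullet> (blk21 P *v u)" for u w
    using inner_transpose_mult[of "blk12 P" u w] by (simp add: sym inner_commute)
  have 22: "(C *v x) \<bullet> (blk22 P *v z) = z \<bullet> (blk21 P *v x)"
    using inner_sym_mats[OF sym(3), of "C *v x" z] by (simp add: C inner_commute)
  have "schur P *v x = blk11 P *v x - blk12 P *v (C *v x)"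
    by (simp add: schur_def C_def matrix_vector_mult_diff_rdistrib matrix_vector_mul_assoc matrix_mul_assoc)
  then show ?thesis
    by (simp add: matrix_mult_vjoin inner_vjoin matrix_vector_right_distrib C 12 22
        inner_add_left inner_add_right inner_diff_right)
qed

section \<open>The S-lemma\<close>

lemma form_add:
  assumes "A \<in> sym_mats"
  shows "(u + t *\<^sub>R w) \<bullet> (A *v (u + t *\<^sub>R w))
    = u \<bullet> (A *v u) + 2 * t * (u \<bullet> (A *v w)) + t\<^sup>2 * (w \<bullet> (A *v w))"
proof -
  have "w \<bullet> (A *v u) = u \<bullet> (A *v w)"
    using inner_sym_mats[OF assms, of w u] by (simp add: inner_commute)
  then show ?thesis
    by (simp add: matrix_vector_right_distrib matrix_vector_mult_scaleR inner_add_left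
        inner_add_right power2_eq_square algebra_simps)
qed

text \<open>With both forms normalised, the isotropic vectors of \<open>Q\<close> in the span of \<open>u\<close> and \<open>w\<close>
  are \<open>u + t w\<close> and \<open>u - w / t\<close>; adding the two inequalities for \<open>M\<close> cancels the cross term.\<close>

lemma S_lemma_plane:
  fixes M Q :: "real^'n^'n"
  assumes M: "M \<in> sym_mats" and Q: "Q \<in> sym_mats"
    and imp: "\<And>v. 0 \<le> v \<bullet> (Q *v v) \<Longrightarrow> 0 \<le> v \<bullet> (M *v v)"
    and u: "u \<bullet> (Q *v u) = 1" and w: "w \<bullet> (Q *v w) = - 1"
  shows "0 \<le> u \<bullet> (M *v u) + w \<bullet> (M *v w)"
proof -
  define b where "b = u \<bullet> (Q *v w)"
  define c where "c = u \<bullet> (M *v w)"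
  define mu where "mu = u \<bullet> (M *v u)"
  define mw where "mw = w \<bullet> (M *v w)"
  \<comment> \<open>The positive root of t^2 - 2 b t - 1, so that the form of Q vanishes at u + t w.
    The second isotropic vector is used below in the rescaled form w - t u, which avoids dividing by
    t.\<close>
  define t where "t = b + sqrt (b\<^sup>2 + 1)"
  have "sqrt (b\<^sup>2 + 1) > \<bar>b\<bar>" by (simp add: real_less_rsqrt)
  then have t: "t > 0" by (simp add: t_def)
  have "(t - b)\<^sup>2 = b\<^sup>2 + 1" by (simp add: t_def)
  then have root: "t\<^sup>2 = 2 * b * t + 1" by (simp add: power2_eq_square algebra_simps)
  have "0 \<le> (u + t *\<^sub>R w) \<bullet> (M *v (u + t *\<^sub>R w))"
    by (rule imp) (use root in \<open>simp add: form_add[OF Q] u w flip: b_def\<close>)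
  then have 1: "0 \<le> mu + 2 * t * c + t\<^sup>2 * mw"
    by (simp add: form_add[OF M] mu_def mw_def c_def)
  have "0 \<le> (w + (- t) *\<^sub>R u) \<bullet> (M *v (w + (- t) *\<^sub>R u))"
  proof (rule imp)
    have "w \<bullet> (Q *v u) = b" by (metis Q b_def inner_commute inner_sym_mats)
    then show "0 \<le> (w + (- t) *\<^sub>R u) \<bullet> (Q *v (w + (- t) *\<^sub>R u))"
      using root unfolding form_add[OF Q] u w by simp
  qed
  moreover have "w \<bullet> (M *v u) = c" by (metis M c_def inner_commute inner_sym_mats)
  ultimately have 2: "0 \<le> mw - 2 * t * c + t\<^sup>2 * mu"
    unfolding form_add[OF M] by (simp add: mu_def mw_def)
  have "0 \<le> (1 + t\<^sup>2) * (mu + mw)" using 1 2 by (simp add: algebra_simps)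
  moreover have "1 + t\<^sup>2 > 0" by (smt (verit) zero_le_power2)
  ultimately show ?thesis by (simp add: zero_le_mult_iff mu_def mw_def)
qed

lemma form_scaleR: "(c *\<^sub>R v) \<bullet> (A *v (c *\<^sub>R v)) = c\<^sup>2 * (v \<bullet> (A *v v))"
  for A :: "real^'n^'n"
  by (simp add: matrix_vector_mult_scaleR power2_eq_square)

text \<open>Rescaling u and w to Q-values 1 and -1 reduces this to \<open>S_lemma_plane\<close>. A
  multiplier must lie between the two kinds of ratio, and this inequality leaves room for
  it.\<close>

lemma S_lemma_ratio:
  fixes M Q :: "real^'n^'n"
  assumes M: "M \<in> sym_mats" and Q: "Q \<in> sym_mats"
    and imp: "\<And>v. 0 \<le> v \<bullet> (Q *v v) \<Longrightarrow> 0 \<le> v \<bullet> (M *v v)"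
    and u: "0 < u \<bullet> (Q *v u)" and w: "w \<bullet> (Q *v w) < 0"
  shows "(w \<bullet> (M *v w)) / (w \<bullet> (Q *v w)) \<le> (u \<bullet> (M *v u)) / (u \<bullet> (Q *v u))"
proof -
  define a where "a = 1 / sqrt (u \<bullet> (Q *v u))"
  define b where "b = 1 / sqrt (- (w \<bullet> (Q *v w)))"
  have a: "a\<^sup>2 = 1 / (u \<bullet> (Q *v u))" using u by (simp add: a_def power_divide)
  have b: "b\<^sup>2 = - 1 / (w \<bullet> (Q *v w))" using w by (simp add: b_def power_divide)
  have "0 \<le> (a *\<^sub>R u) \<bullet> (M *v (a *\<^sub>R u)) + (b *\<^sub>R w) \<bullet> (M *v (b *\<^sub>R w))"
    using u w by (intro S_lemma_plane[OF M Q imp]) (simp_all only: form_scaleR a b, simp_all)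
  then show ?thesis by (simp only: form_scaleR a b) simp
qed

text \<open>The multiplier is the infimum of the ratios over Q-positive vectors, a nonempty set by
  \<open>slater\<close>. Q-positive vectors respect it as a lower bound, Q-negative ones by
  \<open>S_lemma_ratio\<close>, isotropic ones by \<open>imp\<close>.\<close>

lemma S_lemma:
  fixes M Q :: "real^'n^'n"
  assumes M: "M \<in> sym_mats" and Q: "Q \<in> sym_mats"
    and imp: "\<And>v. 0 \<le> v \<bullet> (Q *v v) \<Longrightarrow> 0 \<le> v \<bullet> (M *v v)"
    and slater: "0 < v0 \<bullet> (Q *v v0)"
  shows "\<exists>\<alpha>\<ge>0. \<forall>v. \<alpha> * (v \<bullet> (Q *v v)) \<le> v \<bullet> (M *v v)"
proof -
  define R where "R = (\<lambda>u. (u \<bullet> (M *v u)) / (u \<bullet> (Q *v u))) ` {u. 0 < u \<bullet> (Q *v u)}"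
  define \<alpha> where "\<alpha> = Inf R"
  have ne: "R \<noteq> {}" using slater by (auto simp: R_def)
  have pos: "0 \<le> r" if "r \<in> R" for r using that imp by (auto simp: R_def)
  then have bdd: "bdd_below R" by (meson bdd_belowI)
  have "\<alpha> * (v \<bullet> (Q *v v)) \<le> v \<bullet> (M *v v)" for v
  proof (rule linorder_cases[of "v \<bullet> (Q *v v)" 0])
    assume neg: "v \<bullet> (Q *v v) < 0"
    have "(v \<bullet> (M *v v)) / (v \<bullet> (Q *v v)) \<le> \<alpha>"
      unfolding \<alpha>_def using ne
      by (rule cInf_greatest) (auto simp: R_def intro: S_lemma_ratio[OF M Q imp _ neg])
    then show ?thesis using neg by (simp add: divide_le_eq)
  next
    assume "v \<bullet> (Q *v v) = 0"
    then show ?thesis using imp[of v] by simp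
  next
    assume v: "0 < v \<bullet> (Q *v v)"
    then have "\<alpha> \<le> (v \<bullet> (M *v v)) / (v \<bullet> (Q *v v))"
      unfolding \<alpha>_def by (intro cInf_lower[OF _ bdd]) (auto simp: R_def)
    then show ?thesis using v by (simp add: pos_le_divide_eq)
  qed
  moreover have "0 \<le> \<alpha>" unfolding \<alpha>_def using ne pos by (rule cInf_greatest)
  ultimately show ?thesis by blast
qed

section \<open>A limit argument and a trace bound for quadratic forms\<close>

lemma nonneg_limit_quadratic:
  fixes a b c :: real
  assumes "\<And>t. t \<noteq> 0 \<Longrightarrow> 0 \<le> a + 2 * t * b + t\<^sup>2 * c"
  shows "0 \<le> a"
proof (rule tendsto_lowerbound)
  show "((\<lambda>t. a + 2 * t * b + t\<^sup>2 * c) \<longlongrightarrow> a) (at 0)"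
    by (auto intro!: tendsto_eq_intros)
  show "\<forall>\<^sub>F t in at 0. 0 \<le> a + 2 * t * b + t\<^sup>2 * c"
    using assms by (auto simp: eventually_at_filter)
qed simp

text \<open>Cauchy--Schwarz for the semidefinite form \<open>- A\<close>, avoiding its square root.\<close>

lemma form_le_trace:
  fixes A :: "real^'q^'q" and D :: "real^'p^'q"
  assumes A: "A \<in> sym_mats" and neg: "\<And>v. v \<bullet> (A *v v) \<le> 0"
  shows "(x \<bullet> x) * (\<Sum>i\<in>UNIV. transpose D $ i \<bullet> (A *v transpose D $ i))
    \<le> (D *v x) \<bullet> (A *v (D *v x))"
proof (cases "x = 0")
  case False
  define n where "n = x \<bullet> x"
  have n: "n > 0" using False by (simp add: n_def)
  define y where "y = D *v x"
  let ?d = "\<lambda>i. transpose D $ i"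
  let ?T = "\<Sum>i\<in>UNIV. ?d i \<bullet> (A *v ?d i)"
  have y: "y = (\<Sum>i\<in>UNIV. x $ i *\<^sub>R ?d i)"
    by (simp add: y_def matrix_mult_sum scalar_mult_eq_scaleR column_def transpose_def vec_eq_iff)
  have cross: "(\<Sum>i\<in>UNIV. x $ i * (?d i \<bullet> (A *v y))) = y \<bullet> (A *v y)"
    by (subst (2) y) (simp add: inner_sum_left)
  have n': "(\<Sum>i\<in>UNIV. (x $ i)\<^sup>2) = n"
    by (simp add: n_def inner_vec_def power2_eq_square)
  \<comment> \<open>The vectors are the columns of D (I - x x^T / n), that is, D with its action on
    x projected out. Expanding the sum leaves the trace minus the form at y divided by n.\<close>
  have "(\<Sum>i\<in>UNIV. (?d i + (- x $ i / n) *\<^sub>R y) \<bullet> (A *v (?d i + (- x $ i / n) *\<^sub>R y))) \<le> 0"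
    by (intro sum_nonpos neg)
  also have "(\<Sum>i\<in>UNIV. (?d i + (- x $ i / n) *\<^sub>R y) \<bullet> (A *v (?d i + (- x $ i / n) *\<^sub>R y)))
      = ?T + (- 2 / n) * (\<Sum>i\<in>UNIV. x $ i * (?d i \<bullet> (A *v y)))
        + (1 / n\<^sup>2 * (y \<bullet> (A *v y))) * (\<Sum>i\<in>UNIV. (x $ i)\<^sup>2)"
    unfolding form_add[OF A] sum_distrib_left sum.distrib[symmetric]
    by (intro sum.cong refl) (simp add: power_divide mult.commute mult.left_commute)
  also have "\<dots> = ?T - (y \<bullet> (A *v y)) / n"
    using n unfolding cross n' by (simp add: power2_eq_square field_simps)
  finally show ?thesis using n by (simp add: field_simps n_def y_def)
qed simp


section \<open>The condition on N as a scalar trace inequality\<close>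

lemma matrix_1_form: "x \<bullet> (A *v x) = (x \<bullet> x) * A $ 1 $ 1" for A :: "real^1^1"
  by (simp add: inner_vec_def matrix_vector_mult_def sum_1)

lemma transpose_add: "transpose (A + B) = transpose A + transpose B"
  by (simp add: transpose_def vec_eq_iff)

lemma mvec_add: "mvec (A + B) = mvec A + mvec B"
  by (simp add: mvec_def vec_eq_iff)

text \<open>The square for N is completed at the vectorized transpose of
  \<open>pinv Q22 ** transpose Q12\<close>, since pseudoinverses respect Kronecker products. The
  upper block has size one, so x contributes only the factor \<open>x \<bullet> x\<close>.\<close>

lemma mvec_Zset_iff:
  fixes N :: "real^(1 + 'q::finite \<times> 'p::finite)^(1 + 'q \<times> 'p)" and Z :: "real^'p^'q"
  assumes N: "N \<in> sym_mats" and ker: "mat_ker (blk22 N) \<subseteq> mat_ker (blk12 N)"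
    and N22: "blk22 N = kron Q22 (mat 1 :: real^'p^'p)" and Q22: "Q22 \<in> sym_mats"
    and N21: "blk21 N = mvec Q12"
  defines "D \<equiv> Z + pinv Q22 ** transpose Q12"
  shows "mvec (transpose Z) \<in> Zset N \<longleftrightarrow>
    0 \<le> schur N $ 1 $ 1 + (\<Sum>i\<in>UNIV. transpose D $ i \<bullet> (Q22 *v transpose D $ i))"
    (is "_ \<longleftrightarrow> 0 \<le> ?S")
proof -
  have "pinv (blk22 N) ** blk21 N = mvec (transpose (pinv Q22 ** transpose Q12))"
    by (simp add: N22 N21 pinv_kron pinv_mat_1 kron_mult_mvec matrix_transpose_mul pinv_sym_mats[OF Q22])
  then have "mvec (transpose Z) *v x + pinv (blk22 N) ** blk21 N *v x = mvec (transpose D) *v x" for x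
    by (simp add: D_def transpose_add mvec_add matrix_vector_mult_add_rdistrib)
  then have "vjoin x (mvec (transpose Z) *v x) \<bullet> (N *v vjoin x (mvec (transpose Z) *v x))
      = (x \<bullet> x) * ?S" for x
    by (simp add: form_complete_square[OF N ker] N22 kron_form_mvec matrix_1_form[of x "schur N"]
        distrib_left)
  then have "mvec (transpose Z) \<in> Zset N \<longleftrightarrow> (\<forall>x::real^1. 0 \<le> (x \<bullet> x) * ?S)"
    by (simp add: Zset_iff[OF N])
  also have "\<dots> \<longleftrightarrow> 0 \<le> ?S"
  proof
    assume "\<forall>x::real^1. 0 \<le> (x \<bullet> x) * ?S"
    from this[rule_format, of "axis 1 1"] show "0 \<le> ?S" by (simp add: inner_axis_axis)
  qed simp
  finally show ?thesis .
qed

section \<open>Rank-one test matrices\<close>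

definition outer :: "real^'m \<Rightarrow> real^'n \<Rightarrow> real^'n^'m" where
  "outer a v = (\<chi> i j. a $ i * v $ j)"

lemma outer_nth: "outer a v $ i = a $ i *\<^sub>R v"
  by (simp add: outer_def vec_eq_iff)

lemma outer_mult_vec: "outer a v *v x = (v \<bullet> x) *\<^sub>R a"
  by (simp add: outer_def vec_eq_iff matrix_vector_mult_def inner_vec_def sum_distrib_right
      sum_distrib_left mult.commute mult.left_commute)

lemma transpose_outer: "transpose (outer a v) = outer v a"
  by (simp add: outer_def transpose_def vec_eq_iff mult.commute)

lemma outer_trace_form:
  "(\<Sum>i\<in>UNIV. outer a v $ i \<bullet> (A *v outer a v $ i)) = (a \<bullet> a) * (v \<bullet> (A *v v))"
proof -
  have "(\<Sum>i\<in>UNIV. outer a v $ i \<bullet> (A *v outer a v $ i)) = (\<Sum>i\<in>UNIV. (a $ i * a $ i) * (v \<bullet> (A *v v)))"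
    by (simp add: outer_nth form_scaleR power2_eq_square del: inner_scaleR_left inner_scaleR_right)
  then show ?thesis by (simp add: sum_distrib_right inner_vec_def)
qed

text \<open>Testing on vec (e v^T) with a unit vector e recovers the form of A at v. Here
  \<open>undefined\<close> merely names some index.\<close>

lemma kron_nonpos_imp:
  fixes A :: "real^'q^'q"
  assumes "kron A (mat 1 :: real^'p^'p) \<preceq> 0"
  shows "v \<bullet> (A *v v) \<le> 0"
proof -
  let ?w = "mvec (outer (axis undefined 1 :: real^'p) v) *v (axis 1 1 :: real^1)"
  have "?w \<bullet> (kron A (mat 1) *v ?w) \<le> 0"
    using assms by (simp add: loewner_le_def)
  then show ?thesis
    by (simp add: kron_form_mvec outer_trace_form inner_axis_axis)
qed

text \<open>For v in the kernel of Q22 the test vector is vec (a v^T) with a = Q12 v: it is killed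
  by the Kronecker product, and its pairing with vec Q12 is |Q12 v|^2.\<close>

lemma kron_ker_imp:
  fixes Q12 :: "real^'q^'p" and Q22 :: "real^'q^'q"
  assumes Q22: "Q22 \<in> sym_mats"
    and ker: "mat_ker (kron Q22 (mat 1 :: real^'p^'p)) \<subseteq> mat_ker (transpose (mvec Q12))"
  shows "mat_ker Q22 \<subseteq> mat_ker Q12"
proof
  fix v assume "v \<in> mat_ker Q22"
  then have v: "Q22 *v v = 0" by (simp add: mat_ker_def)
  define a where "a = Q12 *v v"
  define e where "e = (axis 1 1 :: real^1)"
  define w where "w = mvec (outer a v) *v e"
  have "outer a v ** transpose Q22 = 0"
    by (simp add: vec_eq_iff[of "outer a v ** transpose Q22"] matrix_mult_transpose_nth outer_nth
        matrix_vector_mult_scaleR v)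
  then have "kron Q22 (mat 1) *v w = 0"
    by (simp add: w_def matrix_vector_mul_assoc kron_mult_mvec) (simp add: mvec_def matrix_vector_mult_def vec_eq_iff)
  with ker have "transpose (mvec Q12) *v w = 0" by (auto simp: mat_ker_def)
  then have "(mvec Q12 *v e) \<bullet> w = 0"
    using inner_transpose_mult[of "transpose (mvec Q12)" e w] by simp
  then have "(\<Sum>i\<in>UNIV. Q12 $ i \<bullet> outer a v $ i) = 0"
    by (simp add: w_def inner_mvec e_def inner_axis_axis)
  moreover have "(\<Sum>i\<in>UNIV. Q12 $ i \<bullet> outer a v $ i) = a \<bullet> a"
    by (simp add: outer_nth inner_vec_def[of "Q12 *v v"] a_def matrix_vector_mul_component)
  ultimately show "v \<in> mat_ker Q12" by (simp add: a_def mat_ker_def)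
qed

section \<open>Assembling the equivalences\<close>

lemma block_mat_blks:
  "blk11 (block_mat A B C D) = A" "blk12 (block_mat A B C D) = B"
  "blk21 (block_mat A B C D) = C" "blk22 (block_mat A B C D) = D"
  by (simp_all add: block_mat_def blk11_def blk12_def blk21_def blk22_def vec_eq_iff)

lemma block_mat_sym_mats:
  assumes "A \<in> sym_mats" "D \<in> sym_mats"
  shows "block_mat A B (transpose B) D \<in> sym_mats"
  using assms by (auto simp: sym_mats_def block_mat_def transpose_def vec_eq_iff split: sum.split)

lemma sym_mats_add: "A \<in> sym_mats \<Longrightarrow> B \<in> sym_mats \<Longrightarrow> A + B \<in> sym_mats"
  and sym_mats_diff: "A \<in> sym_mats \<Longrightarrow> B \<in> sym_mats \<Longrightarrow> A - B \<in> sym_mats"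
  and sym_mats_scaleR: "A \<in> sym_mats \<Longrightarrow> c *\<^sub>R A \<in> sym_mats"
  and sym_mats_mat: "mat k \<in> sym_mats"
  and sym_mats_zero: "0 \<in> sym_mats"
  by (auto simp: sym_mats_def transpose_def vec_eq_iff mat_def)

theorem theorem2:
  fixes M Q :: "real^('p::finite + 'q::finite)^('p + 'q)"
    and N :: "real^(1 + 'q \<times> 'p)^(1 + 'q \<times> 'p)"
    and Q22 :: "real^'q^'q" and Q12 :: "real^'q^'p" and Q21 :: "real^'p^'q"
    and s :: real
  assumes "M \<in> sym_mats" and "N \<in> Pi_set"
    and "Q22 \<in> sym_mats" and "blk22 N = kron Q22 (mat 1 :: real^'p^'p)"
    and "mvec Q12 = blk21 N" and "Q21 = transpose Q12"
    and "s = schur N $ 1 $ 1"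
    and "Q = block_mat (s *\<^sub>R mat 1 + Q12 ** pinv Q22 ** Q21) Q12 Q21 Q22"
  shows "((\<forall>Z :: real^'p^'q. mvec (transpose Z) \<in> Zset N \<longrightarrow> Z \<in> Zset M) \<longleftrightarrow>
          (\<forall>Z :: real^'p^'q. Z \<in> Zset Q \<longrightarrow> Z \<in> Zset M)) \<and>
         (s > 0 \<longrightarrow>
           ((\<forall>Z :: real^'p^'q. mvec (transpose Z) \<in> Zset N \<longrightarrow> Z \<in> Zset M) \<longleftrightarrow>
            (\<exists>\<alpha>\<ge>0. 0 \<preceq> M - \<alpha> *\<^sub>R Q)))"
proof -
  note M = assms(1) and Q22 = assms(3) and Q_def = assms(8)
  have N: "N \<in> sym_mats" "blk22 N \<preceq> 0" "mat_ker (blk22 N) \<subseteq> mat_ker (blk12 N)"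
    using assms(2) by (auto simp: Pi_set_def)
  \<comment> \<open>The kernel and sign conditions pass from N to the blocks of Q, so the square can
    be completed for Q too.\<close>
  have kerQ: "mat_ker Q22 \<subseteq> mat_ker Q12"
    by (rule kron_ker_imp[OF Q22]) (use N(3) assms(4,5) blk_transpose(2)[OF N(1)] in simp)
  have neg: "v \<bullet> (Q22 *v v) \<le> 0" for v
    by (rule kron_nonpos_imp) (use N(2) assms(4) in simp)
  define C where "C = pinv Q22 ** transpose Q12"
  have Q: "Q \<in> sym_mats"
    unfolding Q_def assms(6)
    by (intro block_mat_sym_mats sym_mats_add sym_mats_scaleR sym_mats_mat Q22)
      (simp add: sym_mats_def matrix_transpose_mul pinv_sym_mats[OF Q22] matrix_mul_assoc)
  \<comment> \<open>The extra term in the upper left block of Q is there to cancel the Schur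
    correction.\<close>
  have schurQ: "schur Q = s *\<^sub>R mat 1"
    by (simp add: schur_def Q_def block_mat_blks)
  have formQ: "vjoin x z \<bullet> (Q *v vjoin x z)
      = s * (x \<bullet> x) + (z + C *v x) \<bullet> (Q22 *v (z + C *v x))" for x z
    using form_complete_square[OF Q, of x z] kerQ
    by (simp add: schurQ) (simp add: Q_def block_mat_blks C_def assms(6) scaleR_matrix_vector_assoc[symmetric])
  have ZN: "mvec (transpose Z) \<in> Zset N \<longleftrightarrow>
      0 \<le> s + (\<Sum>i\<in>UNIV. transpose (Z + C) $ i \<bullet> (Q22 *v transpose (Z + C) $ i))" for Z :: "real^'p^'q"
    unfolding assms(7) C_def by (rule mvec_Zset_iff) (use N assms in auto)

  let ?NM = "\<forall>Z :: real^'p^'q. mvec (transpose Z) \<in> Zset N \<longrightarrow> Z \<in> Zset M"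
  let ?QM = "\<forall>Z :: real^'p^'q. Z \<in> Zset Q \<longrightarrow> Z \<in> Zset M"

  have NQ: "Z \<in> Zset Q" if "mvec (transpose Z) \<in> Zset N" for Z
    unfolding Zset_iff[OF Q] formQ
  proof
    fix x :: "real^'p"
    let ?T = "\<Sum>i\<in>UNIV. transpose (Z + C) $ i \<bullet> (Q22 *v transpose (Z + C) $ i)"
    have "0 \<le> (x \<bullet> x) * (s + ?T)" using that by (simp add: ZN)
    moreover have "(x \<bullet> x) * ?T \<le> ((Z + C) *v x) \<bullet> (Q22 *v ((Z + C) *v x))"
      by (rule form_le_trace[OF Q22 neg])
    ultimately show "0 \<le> s * (x \<bullet> x) + (Z *v x + C *v x) \<bullet> (Q22 *v (Z *v x + C *v x))"
      by (simp add: matrix_vector_mult_add_rdistrib algebra_simps)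
  qed

  have key: "0 \<le> vjoin x z \<bullet> (M *v vjoin x z)"
    if NM: ?NM and x: "x \<noteq> 0" and q: "0 \<le> vjoin x z \<bullet> (Q *v vjoin x z)" for x z
  proof -
    define n where "n = x \<bullet> x"
    have n: "n > 0" using x by (simp add: n_def)
    define y where "y = z + C *v x"
    \<comment> \<open>With this scaling h . x = 1, so that Z x = z, and h . h = 1 / n, so that the
      condition on N for Z + C = y h^T is the condition on Q at (x, z) divided by n.\<close>
    define h where "h = (1 / n) *\<^sub>R x"
    have h: "h \<bullet> x = 1" "h \<bullet> h = 1 / n" using n by (simp_all add: h_def flip: n_def)
    define Z where "Z = outer y h - C"
    have Zx: "Z *v x = z"
      by (simp add: Z_def matrix_vector_mult_diff_rdistrib outer_mult_vec y_def h)
    have "0 \<le> (s * n + y \<bullet> (Q22 *v y)) / n" using q n by (simp add: formQ n_def y_def)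
    then have "0 \<le> s + (h \<bullet> h) * (y \<bullet> (Q22 *v y))" using n by (simp add: h field_simps)
    then have "mvec (transpose Z) \<in> Zset N"
      by (simp add: ZN Z_def transpose_outer outer_trace_form)
    then have "Z \<in> Zset M" using NM by blast
    then show ?thesis unfolding Zset_iff[OF M] using Zx by metis
  qed

  have first: "?NM \<longleftrightarrow> ?QM"
  proof
    assume NM: ?NM
    show ?QM
    proof (intro allI impI)
      fix Z assume Z: "Z \<in> Zset Q"
      have "0 \<le> vjoin x (Z *v x) \<bullet> (M *v vjoin x (Z *v x))" for x
      proof (cases "x = 0")
        case True
        have "vjoin 0 0 = (0 :: real^('p + 'q))"
          by (simp add: vjoin_def vec_eq_iff split: sum.split)
        then show ?thesis using True by simp
      next
        case False
        then show ?thesis using key[OF NM] Z by (auto simp: Zset_iff[OF Q])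
      qed
      then show "Z \<in> Zset M" by (simp add: Zset_iff[OF M])
    qed
  qed (use NQ in blast)

  have second: "?NM \<longleftrightarrow> (\<exists>\<alpha>\<ge>0. 0 \<preceq> M - \<alpha> *\<^sub>R Q)" if s: "s > 0"
  proof -
    have le: "0 \<preceq> M - \<alpha> *\<^sub>R Q \<longleftrightarrow> (\<forall>v. \<alpha> * (v \<bullet> (Q *v v)) \<le> v \<bullet> (M *v v))" for \<alpha>
      using sym_mats_diff[OF M sym_mats_scaleR[OF Q]]
      by (simp add: sym_mats_zero loewner_le_def matrix_vector_mult_diff_rdistrib inner_diff_right
          scaleR_matrix_vector_assoc[symmetric])
    show ?thesis
    proof
      assume NM: ?NM
      define x0 where "x0 = (axis undefined 1 :: real^'p)"
      have x0: "x0 \<noteq> 0" "x0 \<bullet> x0 = 1" by (auto simp: x0_def inner_axis_axis axis_eq_0_iff)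
      \<comment> \<open>The lower block sits at the centre of the square, so the form of Q at
        \<open>v0\<close> is s itself.\<close>
      define v0 where "v0 = vjoin x0 (- (C *v x0))"
      have v0: "0 < v0 \<bullet> (Q *v v0)" using s x0 by (simp add: v0_def formQ)
      have "0 \<le> v \<bullet> (M *v v)" if v: "0 \<le> v \<bullet> (Q *v v)" for v
      proof -
        obtain x z where xz: "v = vjoin x z" by (rule vjoin_cases)
        show ?thesis
        proof (cases "x = 0")
          case False
          then show ?thesis using key[OF NM] v xz by simp
        next
          case True
          show ?thesis
          \<comment> \<open>A vector (0, z) is outside the reach of \<open>key\<close>, so it is
            perturbed along \<open>v0\<close>. The upper block becomes t x0, nonzero, while the
            shifts by C cancel: the form of Q only gains s t^2.\<close>
          proof (rule nonneg_limit_quadratic)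
            fix t :: real assume t: "t \<noteq> 0"
            have eq: "v + t *\<^sub>R v0 = vjoin (t *\<^sub>R x0) (z - t *\<^sub>R (C *v x0))"
              by (simp add: xz True v0_def vjoin_scaleR vjoin_add)
            have "0 \<le> (v + t *\<^sub>R v0) \<bullet> (M *v (v + t *\<^sub>R v0))"
              unfolding eq
              by (rule key[OF NM])
                (use s t x0 v in \<open>auto simp: formQ xz True matrix_vector_mult_scaleR\<close>)
            then show "0 \<le> v \<bullet> (M *v v) + 2 * t * (v \<bullet> (M *v v0)) + t\<^sup>2 * (v0 \<bullet> (M *v v0))"
              by (simp add: form_add[OF M])
          qed
        qed
      qed
      then show "\<exists>\<alpha>\<ge>0. 0 \<preceq> M - \<alpha> *\<^sub>R Q"
        unfolding le using S_lemma[OF M Q _ v0] by blast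
    next
      assume "\<exists>\<alpha>\<ge>0. 0 \<preceq> M - \<alpha> *\<^sub>R Q"
      then have "0 \<le> v \<bullet> (M *v v)" if "0 \<le> v \<bullet> (Q *v v)" for v
        unfolding le using that by (meson mult_nonneg_nonneg order_trans)
      \<comment> \<open>The multiplier yields the implication for Q directly; the first equivalence
        carries it back to N.\<close>
      then have ?QM by (simp add: Zset_iff[OF M] Zset_iff[OF Q])
      with first show ?NM by blast
    qed
  qed
  from first second show ?thesis by blast
qed

end
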